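(* Let $(A,\cdot,\ast,\alpha)$ be an admissible Hom-Novikov-Poisson algebra and let $\beta\colon A\to A$ be a weak morphism. Define $x\cdot_\beta y=\beta(x\cdot y)$ and $x\ast_\beta y=\beta(x\ast y)$ for $x,y\in A$. Then $A_\beta=(A,\cdot_\beta,\ast_\beta,\beta\alpha)$ is also an admissible Hom-Novikov-Poisson algebra. Moreover, if $A$ is multiplicative and $\beta$ is a morphism, then $A_\beta$ is also multiplicative.
   Context: Everything is over a fixed field $\mathbf{k}$ of characteristic $0$. A double Hom-algebra is a quadruple $(A,\cdot,\ast,\alpha)$ where $A$ is a $\mathbf{k}$-vector space, $\cdot$ and $\ast$ are bilinear operations $A\otimes A\to A$, and $\alpha\colon A\to A$ is a linear map (the twisting map). It is multiplicative if $\alpha(x\cdot y)=\alpha(x)\cdot\alpha(y)$ and $\alpha(x\ast y)=\alpha(x)\ast\alpha(y)$ for all $x,y$. A weak morphism $\beta\colon A\to A$ is a linear map with $\beta(x\cdot y)=\beta(x)\cdot\beta(y)$ and $\beta(x\ast y)=\beta(x)\ast\beta(y)$ for all $x,y$. A morphism $\beta\colon A\to A$ is a weak morphism such that $\beta\alpha=\alpha\beta$. Here $\beta\alpha$ denotes composition. A Hom-Novikov-Poisson algebra is a double Hom-algebra $(A,\cdot,\ast,\alpha)$ such that for all $x,y,z\in A$: (1) $(A,\cdot,\alpha)$ is a commutative Hom-associative algebra: $x\cdot y=y\cdot x$ and $(x\cdot y)\cdot\alpha(z)=\alpha(x)\cdot(y\cdot z)$; (2) $(A,\ast,\alpha)$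 is a Hom-Novikov algebra: $(x\ast y)\ast\alpha(z)-\alpha(x)\ast(y\ast z)=(y\ast x)\ast\alpha(z)-\alpha(y)\ast(x\ast z)$ and $(x\ast y)\ast\alpha(z)=(x\ast z)\ast\alpha(y)$; (3) $(x\ast y)\cdot\alpha(z)-\alpha(x)\ast(y\cdot z)=(y\ast x)\cdot\alpha(z)-\alpha(y)\ast(x\cdot z)$; (4) $(x\cdot y)\ast\alpha(z)=(x\ast z)\cdot\alpha(y)$. A Hom-Lie algebra $(A,[,],\alpha)$ is a vector space with a bilinear anti-symmetric bracket and a linear map $\alpha$ satisfying the Hom-Jacobi identity $[[x,y],\alpha(z)]+[[z,x],\alpha(y)]+[[y,z],\alpha(x)]=0$. A Hom-Poisson algebra $(A,\cdot,[,],\alpha)$ consists of a commutative Hom-associative algebra $(A,\cdot,\alpha)$ and a Hom-Lie algebra $(A,[,],\alpha)$ such that the Hom-Leibniz identity $[\alpha(x),y\cdot z]=[x,y]\cdot\alpha(z)+\alpha(y)\cdot[x,z]$ holds for all $x,y,z\in A$. A Hom-Novikov-Poisson algebra $(A,\cdot,\ast,\alpha)$ is admissible if $A^-=(A,\cdot,[,],\alpha)$ is a Hom-Poisson algebra, where $[x,y]=x\ast y-y\ast x$. *)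

theory Defs
  imports Complex_Main
begin

text \<open>The underlying vector space is the whole type \<open>'a\<close> together with the scalar
  multiplication \<open>scale\<close> over a field \<open>'k\<close> of characteristic 0.\<close>

locale hom_algebra = vector_space scale
  for scale :: "'k::field_char_0 \<Rightarrow> 'a::ab_group_add \<Rightarrow> 'a" +
  fixes mul :: "'a \<Rightarrow> 'a \<Rightarrow> 'a" (infixl \<open>\<odot>\<close> 70)
    and alpha :: "'a \<Rightarrow> 'a"
  assumes linear_mul_right: "Vector_Spaces.linear scale scale (\<lambda>y. x \<odot> y)"
    and linear_mul_left: "Vector_Spaces.linear scale scale (\<lambda>x. x \<odot> y)"
    and linear_alpha: "Vector_Spaces.linear scale scale alpha"

locale double_hom_algebra =
  dot: hom_algebra scale mul alpha + star: hom_algebra scale ast alpha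
  for scale :: "'k::field_char_0 \<Rightarrow> 'a::ab_group_add \<Rightarrow> 'a"
    and mul :: "'a \<Rightarrow> 'a \<Rightarrow> 'a" (infixl \<open>\<odot>\<close> 70)
    and ast :: "'a \<Rightarrow> 'a \<Rightarrow> 'a" (infixl \<open>\<star>\<close> 70)
    and alpha :: "'a \<Rightarrow> 'a"

locale multiplicative_double_hom_algebra = double_hom_algebra scale mul ast alpha
  for scale :: "'k::field_char_0 \<Rightarrow> 'a::ab_group_add \<Rightarrow> 'a"
    and mul :: "'a \<Rightarrow> 'a \<Rightarrow> 'a" (infixl \<open>\<odot>\<close> 70)
    and ast :: "'a \<Rightarrow> 'a \<Rightarrow> 'a" (infixl \<open>\<star>\<close> 70)
    and alpha :: "'a \<Rightarrow> 'a" +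
  assumes alpha_mul: "alpha (x \<odot> y) = alpha x \<odot> alpha y"
    and alpha_ast: "alpha (x \<star> y) = alpha x \<star> alpha y"

locale weak_morphism = double_hom_algebra scale mul ast alpha
  for scale :: "'k::field_char_0 \<Rightarrow> 'a::ab_group_add \<Rightarrow> 'a"
    and mul :: "'a \<Rightarrow> 'a \<Rightarrow> 'a" (infixl \<open>\<odot>\<close> 70)
    and ast :: "'a \<Rightarrow> 'a \<Rightarrow> 'a" (infixl \<open>\<star>\<close> 70)
    and alpha :: "'a \<Rightarrow> 'a" +
  fixes beta :: "'a \<Rightarrow> 'a"
  assumes linear_beta: "Vector_Spaces.linear scale scale beta"
    and beta_mul: "beta (x \<odot> y) = beta x \<odot> beta y"
    and beta_ast: "beta (x \<star> y) = beta x \<star> beta y"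

locale hom_morphism = weak_morphism scale mul ast alpha beta
  for scale :: "'k::field_char_0 \<Rightarrow> 'a::ab_group_add \<Rightarrow> 'a"
    and mul :: "'a \<Rightarrow> 'a \<Rightarrow> 'a" (infixl \<open>\<odot>\<close> 70)
    and ast :: "'a \<Rightarrow> 'a \<Rightarrow> 'a" (infixl \<open>\<star>\<close> 70)
    and alpha :: "'a \<Rightarrow> 'a"
    and beta :: "'a \<Rightarrow> 'a" +
  assumes beta_alpha: "beta \<circ> alpha = alpha \<circ> beta"

locale comm_hom_associative_algebra = hom_algebra scale mul alpha
  for scale :: "'k::field_char_0 \<Rightarrow> 'a::ab_group_add \<Rightarrow> 'a"
    and mul :: "'a \<Rightarrow> 'a \<Rightarrow> 'a" (infixl \<open>\<odot>\<close> 70)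
    and alpha :: "'a \<Rightarrow> 'a" +
  assumes mul_commute: "x \<odot> y = y \<odot> x"
    and hom_assoc: "(x \<odot> y) \<odot> alpha z = alpha x \<odot> (y \<odot> z)"

locale hom_novikov_algebra = hom_algebra scale ast alpha
  for scale :: "'k::field_char_0 \<Rightarrow> 'a::ab_group_add \<Rightarrow> 'a"
    and ast :: "'a \<Rightarrow> 'a \<Rightarrow> 'a" (infixl \<open>\<star>\<close> 70)
    and alpha :: "'a \<Rightarrow> 'a" +
  assumes left_symmetric:
      "(x \<star> y) \<star> alpha z - alpha x \<star> (y \<star> z) = (y \<star> x) \<star> alpha z - alpha y \<star> (x \<star> z)"
    and right_commutative: "(x \<star> y) \<star> alpha z = (x \<star> z) \<star> alpha y"

locale hom_novikov_poisson_algebra =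
  double_hom_algebra scale mul ast alpha +
  dot: comm_hom_associative_algebra scale mul alpha +
  star: hom_novikov_algebra scale ast alpha
  for scale :: "'k::field_char_0 \<Rightarrow> 'a::ab_group_add \<Rightarrow> 'a"
    and mul :: "'a \<Rightarrow> 'a \<Rightarrow> 'a" (infixl \<open>\<odot>\<close> 70)
    and ast :: "'a \<Rightarrow> 'a \<Rightarrow> 'a" (infixl \<open>\<star>\<close> 70)
    and alpha :: "'a \<Rightarrow> 'a" +
  assumes ast_mul_left_symmetric:
      "(x \<star> y) \<odot> alpha z - alpha x \<star> (y \<odot> z) = (y \<star> x) \<odot> alpha z - alpha y \<star> (x \<odot> z)"
    and mul_ast: "(x \<odot> y) \<star> alpha z = (x \<star> z) \<odot> alpha y"

locale hom_lie_algebra = hom_algebra scale br alpha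
  for scale :: "'k::field_char_0 \<Rightarrow> 'a::ab_group_add \<Rightarrow> 'a"
    and br :: "'a \<Rightarrow> 'a \<Rightarrow> 'a"
    and alpha :: "'a \<Rightarrow> 'a" +
  assumes antisymmetric: "br x y = - br y x"
    and hom_jacobi: "br (br x y) (alpha z) + br (br z x) (alpha y) + br (br y z) (alpha x) = 0"

locale hom_poisson_algebra =
  dot: comm_hom_associative_algebra scale mul alpha + lie: hom_lie_algebra scale br alpha
  for scale :: "'k::field_char_0 \<Rightarrow> 'a::ab_group_add \<Rightarrow> 'a"
    and mul :: "'a \<Rightarrow> 'a \<Rightarrow> 'a" (infixl \<open>\<odot>\<close> 70)
    and br :: "'a \<Rightarrow> 'a \<Rightarrow> 'a"
    and alpha :: "'a \<Rightarrow> 'a" +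
  assumes hom_leibniz: "br (alpha x) (y \<odot> z) = br x y \<odot> alpha z + alpha y \<odot> br x z"

locale admissible_hom_novikov_poisson_algebra = hom_novikov_poisson_algebra scale mul ast alpha
  for scale :: "'k::field_char_0 \<Rightarrow> 'a::ab_group_add \<Rightarrow> 'a"
    and mul :: "'a \<Rightarrow> 'a \<Rightarrow> 'a" (infixl \<open>\<odot>\<close> 70)
    and ast :: "'a \<Rightarrow> 'a \<Rightarrow> 'a" (infixl \<open>\<star>\<close> 70)
    and alpha :: "'a \<Rightarrow> 'a" +
  assumes admissible: "hom_poisson_algebra scale mul (\<lambda>x y. x \<star> y - y \<star> x) alpha"

end

theory Submission
  imports Defs
begin

text \<open>
  Apart from commutativity and anti-symmetry, every identity defining an admissible
  Hom-Novikov-Poisson algebra is a linear relation between terms of one shape: two nested products,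
  with \<open>alpha\<close> applied once, to the argument outside the inner product. If \<open>beta\<close> respects the
  products, such a term evaluated in the twisted algebra is \<open>beta \<circ> beta\<close> applied to the original
  term, for instance
  \<open>beta (ast (beta (mul x y)) (beta (alpha z))) = beta (beta (ast (mul x y) (alpha z)))\<close>.
  As \<open>beta\<close> is linear, each such identity of the twisted algebra is the image of the original one
  under \<open>beta \<circ> beta\<close>; commutativity and anti-symmetry are images under \<open>beta\<close>. Nowhere is \<open>beta\<close>
  moved past \<open>alpha\<close>, which is why a weak morphism suffices. Admissibility is inherited in the same
  way: \<open>beta\<close> preserves the commutator as well, and by linearity the commutator of the twisted
  product is the twist of the commutator. Multiplicativity is different: \<open>beta \<circ> alpha\<close> has to
  respect the products \<open>beta (mul x y)\<close>, so \<open>alpha\<close> meets \<open>beta\<close> from the outside, and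
  it is here that the two maps must commute.
\<close>

lemma hom_algebra_twist:
  assumes "hom_algebra scale mul alpha" and beta: "Vector_Spaces.linear scale scale beta"
  shows "hom_algebra scale (\<lambda>x y. beta (mul x y)) (beta \<circ> alpha)"
proof -
  interpret hom_algebra scale mul alpha by fact
  show ?thesis
    by (intro hom_algebra.intro hom_algebra_axioms.intro vector_space_axioms
        Vector_Spaces.linear_compose[OF linear_mul_right beta, unfolded comp_def]
        Vector_Spaces.linear_compose[OF linear_mul_left beta, unfolded comp_def]
        Vector_Spaces.linear_compose[OF linear_alpha beta])
qed

lemma comm_hom_associative_algebra_twist:
  assumes "comm_hom_associative_algebra scale mul alpha"
    and beta: "Vector_Spaces.linear scale scale beta"
    and beta_mul: "\<And>x y. beta (mul x y) = mul (beta x) (beta y)"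
  shows "comm_hom_associative_algebra scale (\<lambda>x y. beta (mul x y)) (beta \<circ> alpha)"
proof -
  interpret comm_hom_associative_algebra scale mul alpha by fact
  interpret twist: hom_algebra scale "\<lambda>x y. beta (mul x y)" "beta \<circ> alpha"
    by (rule hom_algebra_twist[OF hom_algebra_axioms beta])
  show ?thesis
  proof
    show "beta (mul x y) = beta (mul y x)" for x y
      by (simp only: mul_commute)
    show "beta (mul (beta (mul x y)) ((beta \<circ> alpha) z))
        = beta (mul ((beta \<circ> alpha) x) (beta (mul y z)))" for x y z
      by (simp only: o_apply beta_mul[symmetric] hom_assoc)
  qed
qed

lemma hom_novikov_algebra_twist:
  assumes "hom_novikov_algebra scale ast alpha"
    and beta: "Vector_Spaces.linear scale scale beta"
    and beta_ast: "\<And>x y. beta (ast x y) = ast (beta x) (beta y)"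
  shows "hom_novikov_algebra scale (\<lambda>x y. beta (ast x y)) (beta \<circ> alpha)"
proof -
  interpret hom_novikov_algebra scale ast alpha by fact
  interpret beta: Vector_Spaces.linear scale scale beta by fact
  interpret twist: hom_algebra scale "\<lambda>x y. beta (ast x y)" "beta \<circ> alpha"
    by (rule hom_algebra_twist[OF hom_algebra_axioms beta])
  show ?thesis
  proof
    show "beta (ast (beta (ast x y)) ((beta \<circ> alpha) z))
          - beta (ast ((beta \<circ> alpha) x) (beta (ast y z)))
        = beta (ast (beta (ast y x)) ((beta \<circ> alpha) z))
          - beta (ast ((beta \<circ> alpha) y) (beta (ast x z)))" for x y z
      by (simp only: o_apply beta_ast[symmetric] beta.diff[symmetric] left_symmetric[of x y z])
    show "beta (ast (beta (ast x y)) ((beta \<circ> alpha) z))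
        = beta (ast (beta (ast x z)) ((beta \<circ> alpha) y))" for x y z
      by (simp only: o_apply beta_ast[symmetric] right_commutative[of x y z])
  qed
qed

lemma hom_novikov_poisson_algebra_twist:
  assumes "hom_novikov_poisson_algebra scale mul ast alpha"
    and beta: "Vector_Spaces.linear scale scale beta"
    and beta_mul: "\<And>x y. beta (mul x y) = mul (beta x) (beta y)"
    and beta_ast: "\<And>x y. beta (ast x y) = ast (beta x) (beta y)"
  shows "hom_novikov_poisson_algebra scale
           (\<lambda>x y. beta (mul x y)) (\<lambda>x y. beta (ast x y)) (beta \<circ> alpha)"
proof -
  interpret hom_novikov_poisson_algebra scale mul ast alpha by fact
  interpret beta: Vector_Spaces.linear scale scale beta by fact
  interpret dot_twist: comm_hom_associative_algebra scale "\<lambda>x y. beta (mul x y)" "beta \<circ> alpha"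
    by (rule comm_hom_associative_algebra_twist
        [OF dot.comm_hom_associative_algebra_axioms beta, OF beta_mul])
  interpret star_twist: hom_novikov_algebra scale "\<lambda>x y. beta (ast x y)" "beta \<circ> alpha"
    by (rule hom_novikov_algebra_twist[OF star.hom_novikov_algebra_axioms beta, OF beta_ast])
  show ?thesis
  proof
    show "beta (mul (beta (ast x y)) ((beta \<circ> alpha) z))
          - beta (ast ((beta \<circ> alpha) x) (beta (mul y z)))
        = beta (mul (beta (ast y x)) ((beta \<circ> alpha) z))
          - beta (ast ((beta \<circ> alpha) y) (beta (mul x z)))" for x y z
      by (simp only: o_apply beta_mul[symmetric] beta_ast[symmetric] beta.diff[symmetric]
          ast_mul_left_symmetric[of x y z])
    show "beta (ast (beta (mul x y)) ((beta \<circ> alpha) z))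
        = beta (mul (beta (ast x z)) ((beta \<circ> alpha) y))" for x y z
      by (simp only: o_apply beta_mul[symmetric] beta_ast[symmetric] mul_ast)
  qed
qed

lemma hom_lie_algebra_twist:
  assumes "hom_lie_algebra scale br alpha"
    and beta: "Vector_Spaces.linear scale scale beta"
    and beta_br: "\<And>x y. beta (br x y) = br (beta x) (beta y)"
  shows "hom_lie_algebra scale (\<lambda>x y. beta (br x y)) (beta \<circ> alpha)"
proof -
  interpret hom_lie_algebra scale br alpha by fact
  interpret beta: Vector_Spaces.linear scale scale beta by fact
  interpret twist: hom_algebra scale "\<lambda>x y. beta (br x y)" "beta \<circ> alpha"
    by (rule hom_algebra_twist[OF hom_algebra_axioms beta])
  show ?thesis
  proof
    show "beta (br x y) = - beta (br y x)" for x y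
      by (simp only: antisymmetric[of x y] beta.neg)
    show "beta (br (beta (br x y)) ((beta \<circ> alpha) z)) + beta (br (beta (br z x)) ((beta \<circ> alpha) y))
        + beta (br (beta (br y z)) ((beta \<circ> alpha) x)) = 0" for x y z
      by (simp only: o_apply beta_br[symmetric] beta.add[symmetric] hom_jacobi beta.zero)
  qed
qed

lemma hom_poisson_algebra_twist:
  assumes "hom_poisson_algebra scale mul br alpha"
    and beta: "Vector_Spaces.linear scale scale beta"
    and beta_mul: "\<And>x y. beta (mul x y) = mul (beta x) (beta y)"
    and beta_br: "\<And>x y. beta (br x y) = br (beta x) (beta y)"
  shows "hom_poisson_algebra scale
           (\<lambda>x y. beta (mul x y)) (\<lambda>x y. beta (br x y)) (beta \<circ> alpha)"
proof -
  interpret hom_poisson_algebra scale mul br alpha by fact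
  interpret beta: Vector_Spaces.linear scale scale beta by fact
  interpret dot_twist: comm_hom_associative_algebra scale "\<lambda>x y. beta (mul x y)" "beta \<circ> alpha"
    by (rule comm_hom_associative_algebra_twist
        [OF dot.comm_hom_associative_algebra_axioms beta, OF beta_mul])
  interpret lie_twist: hom_lie_algebra scale "\<lambda>x y. beta (br x y)" "beta \<circ> alpha"
    by (rule hom_lie_algebra_twist[OF lie.hom_lie_algebra_axioms beta, OF beta_br])
  show ?thesis
  proof
    show "beta (br ((beta \<circ> alpha) x) (beta (mul y z)))
        = beta (mul (beta (br x y)) ((beta \<circ> alpha) z))
          + beta (mul ((beta \<circ> alpha) y) (beta (br x z)))" for x y z
      by (simp only: o_apply beta_mul[symmetric] beta_br[symmetric] beta.add[symmetric]
          hom_leibniz)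
  qed
qed

lemma multiplicative_double_hom_algebra_twist:
  assumes "multiplicative_double_hom_algebra scale mul ast alpha"
    and "hom_morphism scale mul ast alpha beta"
  shows "multiplicative_double_hom_algebra scale
           (\<lambda>x y. beta (mul x y)) (\<lambda>x y. beta (ast x y)) (beta \<circ> alpha)"
proof -
  interpret multiplicative_double_hom_algebra scale mul ast alpha by fact
  interpret hom_morphism scale mul ast alpha beta by fact
  interpret dot_twist: hom_algebra scale "\<lambda>x y. beta (mul x y)" "beta \<circ> alpha"
    by (rule hom_algebra_twist[OF dot.hom_algebra_axioms linear_beta])
  interpret star_twist: hom_algebra scale "\<lambda>x y. beta (ast x y)" "beta \<circ> alpha"
    by (rule hom_algebra_twist[OF star.hom_algebra_axioms linear_beta])
  have alpha_beta: "alpha (beta x) = beta (alpha x)" for x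
    using fun_cong[OF beta_alpha, of x] by simp
  show ?thesis
    by unfold_locales (simp_all add: alpha_beta alpha_mul alpha_ast beta_mul beta_ast)
qed

theorem corollary5p7:
  fixes scale :: "'k::field_char_0 \<Rightarrow> 'a::ab_group_add \<Rightarrow> 'a"
    and mul ast :: "'a \<Rightarrow> 'a \<Rightarrow> 'a"
    and alpha beta :: "'a \<Rightarrow> 'a"
  assumes "admissible_hom_novikov_poisson_algebra scale mul ast alpha"
    and "weak_morphism scale mul ast alpha beta"
  shows "admissible_hom_novikov_poisson_algebra scale
           (\<lambda>x y. beta (mul x y)) (\<lambda>x y. beta (ast x y)) (beta \<circ> alpha) \<and>
         (multiplicative_double_hom_algebra scale mul ast alpha \<and>
          hom_morphism scale mul ast alpha beta \<longrightarrow>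
          multiplicative_double_hom_algebra scale
            (\<lambda>x y. beta (mul x y)) (\<lambda>x y. beta (ast x y)) (beta \<circ> alpha))"
proof -
  interpret admissible_hom_novikov_poisson_algebra scale mul ast alpha by fact
  interpret weak_morphism scale mul ast alpha beta by fact
  interpret beta: Vector_Spaces.linear scale scale beta by (rule linear_beta)
  have commutator: "beta (ast x y - ast y x) = ast (beta x) (beta y) - ast (beta y) (beta x)" for x y
    by (simp only: beta.diff beta_ast)
  have "hom_poisson_algebra scale (\<lambda>x y. beta (mul x y))
          (\<lambda>x y. beta (ast x y) - beta (ast y x)) (beta \<circ> alpha)"
    using hom_poisson_algebra_twist[OF admissible linear_beta, OF beta_mul commutator]
    by (simp only: beta.diff)
  then have "admissible_hom_novikov_poisson_algebra scale
          (\<lambda>x y. beta (mul x y)) (\<lambda>x y. beta (ast x y)) (beta \<circ> alpha)"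
    by (intro admissible_hom_novikov_poisson_algebra.intro
        admissible_hom_novikov_poisson_algebra_axioms.intro
        hom_novikov_poisson_algebra_twist[OF hom_novikov_poisson_algebra_axioms
          linear_beta, OF beta_mul beta_ast])
  then show ?thesis
    using multiplicative_double_hom_algebra_twist by blast
qed

end
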